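(* Let $n>1$ be an integer, let $\sigma$ be a permutation of $\{1,\ldots,n\}$, and let $k\in\mathbb{R}$. Then the inequality $$\sum_{i=1}^{n}\left(\frac{x_i}{x_{i+1}}\right)^k\geq \sum_{i=1}^{n}\frac{x_i}{x_{\sigma(i)}}$$ holds for all positive real numbers $x_1,\ldots,x_n$ (where $x_{n+1}:=x_1$) if and only if at least one of the following two conditions is satisfied: (1) $k\geq 0$, and $k\geq \sigma(i)-i$ for every $i\in\{1,\ldots,n\}$ with $i\leq\sigma(i)$, and $k\geq n+\sigma(i)-i$ for every $i\in\{1,\ldots,n\}$ with $i>\sigma(i)$; (2) $k\leq 0$, and $-k\geq n+i-\sigma(i)$ for every $i\in\{1,\ldots,n\}$ with $i<\sigma(i)$, and $-k\geq i-\sigma(i)$ for every $i\in\{1,\ldots,n\}$ with $i\geq\sigma(i)$.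
   Context: Indices of the variables $x_1,\ldots,x_n$ are understood cyclically modulo $n$. *)

theory Defs
  imports Complex_Main "HOL-Combinatorics.Permutations"
begin

end

theory Submission
  imports Defs
begin

text \<open>
  Let \<open>d\<close> be the cyclic distance from \<open>i\<close> to \<open>\<sigma> i\<close>, so that \<open>x i / x (\<sigma> i)\<close> is the product of the
  \<open>d\<close> ratios \<open>x j / x (j + 1)\<close> along the cyclic arc from \<open>i\<close> to \<open>\<sigma> i\<close>. For \<open>k \<ge> 0\<close> the criterion is
  that every such \<open>d\<close> is at most \<open>k\<close>. If it holds, weighted AM-GM bounds \<open>k * x i / x (\<sigma> i)\<close> by the
  sum of the \<open>k\<close>-th powers along the arc plus \<open>k - d\<close>; as \<open>\<sigma>\<close> is a permutation, the arcs cover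
  every \<open>j\<close> equally often, and summing over \<open>i\<close> gives the inequality. If some \<open>d\<close> exceeds \<open>k\<close>,
  taking all ratios on that arc equal to a large \<open>t\<close>, and the others equal and below 1, gives
  \<open>t ^ d\<close> on the right against at most \<open>n * t powr k\<close> on the left. Replacing \<open>x\<close> by \<open>1 / x\<close> exchanges
  \<open>(\<sigma>, k)\<close> with \<open>(inv \<sigma>, -k)\<close>, which settles \<open>k \<le> 0\<close>.
\<close>

definition cyclic_ineq :: "nat \<Rightarrow> (nat \<Rightarrow> nat) \<Rightarrow> real \<Rightarrow> bool" where
  "cyclic_ineq n \<sigma> k \<longleftrightarrow>
    (\<forall>x :: nat \<Rightarrow> real.
       (\<forall>i\<in>{1..n}. x i > 0) \<longrightarrow> x (n + 1) = x 1 \<longrightarrow>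
       (\<Sum>i = 1..n. (x i / x (i + 1)) powr k) \<ge> (\<Sum>i = 1..n. x i / x (\<sigma> i)))"

text \<open>Half-open, so that the differences \<open>y l - y (l + 1)\<close> over the arc telescope
  to \<open>y i - y j\<close>. For \<open>i = j\<close> the arc is empty rather than a full turn,
  which gives a fixed point of \<open>\<sigma>\<close> distance 0.\<close>

definition arc :: "nat \<Rightarrow> nat \<Rightarrow> nat \<Rightarrow> nat set" where
  "arc n i j = (if i \<le> j then {i..<j} else {i..n} \<union> {1..<j})"

lemma finite_arc [simp]: "finite (arc n i j)"
  by (simp add: arc_def)

lemma arc_subset: "i \<in> {1..n} \<Longrightarrow> j \<in> {1..n} \<Longrightarrow> arc n i j \<subseteq> {1..n}"
  by (auto simp: arc_def)

text \<open>Prefix sums separate the contributions of the two end points, apart from one full turn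
  for an arc that wraps around. In this form the arc sums can be added up over a
  permutation.\<close>

lemma sum_arc:
  fixes f :: "nat \<Rightarrow> real"
  assumes "i \<in> {1..n}" "j \<in> {1..n}"
  shows "sum f (arc n i j) =
    sum f {1..<j} - sum f {1..<i} + (if j < i then sum f {1..n} else 0)"
proof (cases "i \<le> j")
  case True
  have "sum f {1..<i} + sum f {i..<j} = sum f {1..<j}"
    using assms True by (intro sum.atLeastLessThan_concat) auto
  then show ?thesis using True by (simp add: arc_def)
next
  case False
  have "sum f {1..<i} + sum f {i..<Suc n} = sum f {1..<Suc n}"
    using assms by (intro sum.atLeastLessThan_concat) auto
  moreover have "sum f ({i..n} \<union> {1..<j}) = sum f {i..n} + sum f {1..<j}"
    using False by (intro sum.union_disjoint) auto
  ultimately show ?thesis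
    using False by (simp add: arc_def atLeastLessThanSuc_atLeastAtMost)
qed

lemma card_arc:
  assumes "i \<in> {1..n}" "j \<in> {1..n}"
  shows "real (card (arc n i j)) = real j - real i + (if j < i then real n else 0)"
  using sum_arc[OF assms, of "\<lambda>_. 1"] assms by (simp add: of_nat_diff)

lemma sum_diff_arc:
  fixes y :: "nat \<Rightarrow> real"
  assumes "i \<in> {1..n}" "j \<in> {1..n}" "y (n + 1) = y 1"
  shows "(\<Sum>l\<in>arc n i j. y l - y (l + 1)) = y i - y j"
proof -
  have tel: "(\<Sum>l = 1..<m. y l - y (l + 1)) = y 1 - y m" if "m \<ge> 1" for m
    using that by (induction m rule: dec_induct) auto
  show ?thesis
    using assms tel[of "n + 1"] tel[of i] tel[of j]
    by (simp add: sum_arc atLeastLessThanSuc_atLeastAtMost)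
qed

text \<open>Reindexing by \<open>\<sigma>\<close> cancels the prefix sums at
  \<open>\<sigma> i\<close> against those at \<open>i\<close>. What remains is one full sum for each
  arc that wraps around.\<close>

lemma sum_arcs_permutes:
  fixes f :: "nat \<Rightarrow> real"
  assumes "\<sigma> permutes {1..n}"
  shows "(\<Sum>i = 1..n. sum f (arc n i (\<sigma> i))) = real (card {i\<in>{1..n}. \<sigma> i < i}) * sum f {1..n}"
proof -
  let ?F = "\<lambda>m. sum f {1..<m}"
  have "(\<Sum>i = 1..n. sum f (arc n i (\<sigma> i))) =
      (\<Sum>i = 1..n. ?F (\<sigma> i) - ?F i + (if \<sigma> i < i then sum f {1..n} else 0))"
    using permutes_in_image[OF assms] by (intro sum.cong refl sum_arc) auto
  also have "\<dots> = (\<Sum>i = 1..n. ?F (\<sigma> i)) - (\<Sum>i = 1..n. ?F i)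
      + (\<Sum>i = 1..n. if \<sigma> i < i then sum f {1..n} else 0)"
    by (simp only: sum.distrib sum_subtractf)
  also have "(\<Sum>i = 1..n. ?F (\<sigma> i)) = (\<Sum>i = 1..n. ?F i)"
    using sum.permute[OF assms, of ?F] by (simp add: o_def)
  also have "(\<Sum>i = 1..n. if \<sigma> i < i then sum f {1..n} else 0) =
      real (card {i\<in>{1..n}. \<sigma> i < i}) * sum f {1..n}"
    by (subst sum.inter_filter[symmetric]) auto
  finally show ?thesis by simp
qed

text \<open>Weighted AM-GM, obtained from the tangent of \<open>exp\<close> at the weighted mean \<open>s\<close>.\<close>

lemma exp_mean_le_sum:
  fixes z :: "'a \<Rightarrow> real"
  assumes "finite A" "real (card A) \<le> k" "sum z A = k * s"
  shows "k * exp s \<le> (\<Sum>j\<in>A. exp (z j)) + (k - real (card A))"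
proof -
  have tangent: "exp s * (1 + u - s) \<le> exp u" for u :: real
    using mult_left_mono[OF exp_ge_add_one_self[of "u - s"], of "exp s"]
    by (simp add: exp_add[symmetric] algebra_simps)
  have "(\<Sum>j\<in>A. exp s * (1 + z j - s)) = exp s * (real (card A) + sum z A - real (card A) * s)"
    by (simp add: sum_distrib_left[symmetric] sum.distrib sum_subtractf)
  moreover have "(\<Sum>j\<in>A. exp s * (1 + z j - s)) \<le> (\<Sum>j\<in>A. exp (z j))"
    by (intro sum_mono tangent)
  \<comment> \<open>The slack \<open>k - card A\<close> is the weight of an extra value
    \<open>0\<close>. The total weight becomes \<open>k\<close> and the weighted mean
    \<open>s\<close>, so the tangent values add up to \<open>k * exp s\<close>.\<close>
  moreover have "(k - real (card A)) * (exp s * (1 + 0 - s)) \<le> (k - real (card A)) * exp 0"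
    using assms by (intro mult_left_mono tangent) auto
  ultimately show ?thesis
    using assms by (simp add: algebra_simps)
qed

lemma cyclic_ineq_if_arcs_le:
  assumes \<sigma>: "\<sigma> permutes {1..n}" and "n > 0" and "k \<ge> 0"
    and le: "\<And>i. i \<in> {1..n} \<Longrightarrow> real (card (arc n i (\<sigma> i))) \<le> k"
  shows "cyclic_ineq n \<sigma> k"
  unfolding cyclic_ineq_def
proof (intro allI impI)
  fix x :: "nat \<Rightarrow> real"
  assume pos: "\<forall>i\<in>{1..n}. x i > 0" and per: "x (n + 1) = x 1"
  define y where "y i = ln (x i)" for i
  define z where "z j = k * (y j - y (j + 1))" for j
  define T where "T = (\<Sum>j = 1..n. exp (z j))"
  define m where "m = real (card {i\<in>{1..n}. \<sigma> i < i})"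
  have \<sigma>_in: "\<sigma> i \<in> {1..n}" if "i \<in> {1..n}" for i
    using permutes_in_image[OF \<sigma>] that by simp
  have pos': "x (i + 1) > 0" if "i \<in> {1..n}" for i
    using pos per that \<open>n > 0\<close> by (cases "i = n") auto
  have y_per: "y (n + 1) = y 1"
    using per by (simp add: y_def)
  have "(\<Sum>i = 1..n. (x i / x (i + 1)) powr k) = T"
    unfolding T_def
  proof (intro sum.cong refl)
    fix i assume "i \<in> {1..n}"
    then have "x i > 0" "x (i + 1) > 0" using pos pos' by auto
    then show "(x i / x (i + 1)) powr k = exp (z i)"
      by (simp add: powr_def ln_div z_def y_def)
  qed
  moreover have "(\<Sum>i = 1..n. x i / x (\<sigma> i)) = (\<Sum>i = 1..n. exp (y i - y (\<sigma> i)))"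
    using pos \<sigma>_in by (intro sum.cong refl) (simp add: y_def exp_diff)
  moreover have "(\<Sum>i = 1..n. exp (y i - y (\<sigma> i))) \<le> T"
  \<comment> \<open>The other case ends by cancelling the factor \<open>k\<close>. For
    \<open>k = 0\<close> every arc is empty, so \<open>y i = y (\<sigma> i)\<close> and both sides
    equal \<open>n\<close>.\<close>
  proof (cases "k = 0")
    case True
    have "y i - y (\<sigma> i) = 0" if "i \<in> {1..n}" for i
      using le[OF that] sum_diff_arc[OF that \<sigma>_in[OF that] y_per] True by simp
    then show ?thesis using True by (simp add: T_def z_def)
  next
    case False
    have sum_z: "sum z (arc n i (\<sigma> i)) = k * (y i - y (\<sigma> i))" if "i \<in> {1..n}" for i
      using sum_diff_arc[OF that \<sigma>_in[OF that] y_per]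
      by (simp add: z_def sum_distrib_left[symmetric])
    have arcs_card: "(\<Sum>i = 1..n. real (card (arc n i (\<sigma> i)))) = m * n"
      using sum_arcs_permutes[OF \<sigma>, of "\<lambda>_. 1"] by (simp add: m_def)
    have "k * (\<Sum>i = 1..n. exp (y i - y (\<sigma> i))) \<le>
        (\<Sum>i = 1..n. (\<Sum>j\<in>arc n i (\<sigma> i). exp (z j)) + (k - real (card (arc n i (\<sigma> i)))))"
      unfolding sum_distrib_left
      by (intro sum_mono exp_mean_le_sum le sum_z finite_arc)
    also have "\<dots> = m * T + (k - m) * n"
      using sum_arcs_permutes[OF \<sigma>, of "\<lambda>j. exp (z j)"] arcs_card
      by (simp add: sum.distrib sum_subtractf m_def T_def algebra_simps)
    \<comment> \<open>The gap is \<open>(k - m) * (T - n)\<close>. Here \<open>m \<le> k\<close>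
      because \<open>m\<close> is the mean arc length, and \<open>n \<le> T\<close> because the
      \<open>z j\<close> sum to 0 around the cycle.\<close>
    also have "\<dots> \<le> k * T"
    proof -
      have "m * n \<le> k * n"
        using sum_mono[OF le, of "{1..n}" "\<lambda>i. i"] arcs_card by (simp add: mult.commute)
      then have "m \<le> k" using \<open>n > 0\<close> by simp
      have "(\<Sum>j = 1..n. y j - y (j + 1)) = y 1 - y (n + 1)"
        using \<open>n > 0\<close> sum_Suc_diff[of 1 n y] by (simp add: sum_subtractf)
      then have "sum z {1..n} = 0"
        using y_per by (simp add: z_def sum_distrib_left[symmetric])
      moreover have "(\<Sum>j = 1..n. 1 + z j) \<le> T"
        unfolding T_def by (intro sum_mono exp_ge_add_one_self)
      ultimately have "n \<le> T" by (simp add: sum.distrib)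
      then have "0 \<le> (k - m) * (T - n)" using \<open>m \<le> k\<close> by simp
      then show ?thesis by (simp add: algebra_simps)
    qed
    finally show ?thesis using False \<open>k \<ge> 0\<close> by simp
  qed
  ultimately show "(\<Sum>i = 1..n. x i / x (\<sigma> i)) \<le> (\<Sum>i = 1..n. (x i / x (i + 1)) powr k)"
    by simp
qed

lemma card_arc_le_if_cyclic_ineq:
  assumes \<sigma>: "\<sigma> permutes {1..n}" and "k \<ge> 0"
    and ineq: "cyclic_ineq n \<sigma> k" and i: "i \<in> {1..n}"
  shows "real (card (arc n i (\<sigma> i))) \<le> k"
proof (rule ccontr)
  define A where "A = arc n i (\<sigma> i)"
  define d where "d = real (card A)"
  assume "\<not> real (card (arc n i (\<sigma> i))) \<le> k"
  then have "k < d" by (simp add: d_def A_def)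
  have \<sigma>i: "\<sigma> i \<in> {1..n}" using permutes_in_image[OF \<sigma>] i by simp
  \<comment> \<open>Even an arc that wraps around misses some index, so there is room for
    compensating ratios off the arc.\<close>
  have "d < n" using card_arc[OF i \<sigma>i] i \<sigma>i by (auto simp: d_def A_def)
  \<comment> \<open>Solves \<open>exp ((d - k) * L) = n + 1\<close>, just beyond what the
    \<open>n\<close> terms of the left side allow.\<close>
  define L where "L = ln (real n + 1) / (d - k)"
  have "L \<ge> 0" using \<open>k < d\<close> by (simp add: L_def)
  \<comment> \<open>The logarithms of the consecutive ratios. The value off \<open>A\<close> makes
    them sum to 0, which closes the cycle: \<open>y (n + 1) = y 1\<close>.\<close>
  define a where "a j = (if j \<in> A then L else - (d * L / (n - d)))" for j
  have a_le: "a j \<le> L" for j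
  proof -
    have "- (d * L / (n - d)) \<le> 0"
      using \<open>L \<ge> 0\<close> \<open>d < n\<close> \<open>k < d\<close> \<open>k \<ge> 0\<close> by simp
    then show ?thesis using \<open>L \<ge> 0\<close> unfolding a_def by auto
  qed
  define y where "y j = - sum a {1..<j}" for j
  have A: "A \<subseteq> {1..n}" unfolding A_def by (rule arc_subset[OF i \<sigma>i])
  have "sum a {1..n} = sum a ({1..n} - A) + sum a A"
    by (rule sum.subset_diff[OF A]) simp
  also have "sum a A = d * L" by (simp add: a_def d_def)
  also have "sum a ({1..n} - A) = - (d * L)"
  proof -
    have "real (card ({1..n} - A)) = n - d"
      using A card_mono[OF _ A] by (simp add: card_Diff_subset finite_subset d_def of_nat_diff)
    then show ?thesis using \<open>d < n\<close> by (simp add: a_def)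
  qed
  finally have y_per: "y (n + 1) = y 1"
    by (simp add: y_def atLeastLessThanSuc_atLeastAtMost)
  have step: "y j - y (j + 1) = a j" if "j \<in> {1..n}" for j
    using that by (simp add: y_def)
  have "exp (d * L) = exp (y i) / exp (y (\<sigma> i))"
  proof -
    have "y i - y (\<sigma> i) = sum a A"
      using sum_diff_arc[OF i \<sigma>i y_per] A step unfolding A_def
      by (metis (no_types, lifting) sum.cong subset_iff)
    then show ?thesis by (simp add: exp_diff[symmetric] a_def d_def)
  qed
  also have "\<dots> \<le> (\<Sum>j = 1..n. exp (y j) / exp (y (\<sigma> j)))"
    using i by (intro member_le_sum) auto
  also have "\<dots> \<le> (\<Sum>j = 1..n. (exp (y j) / exp (y (j + 1))) powr k)"
    using ineq[unfolded cyclic_ineq_def, rule_format, of "\<lambda>j. exp (y j)"] y_per by simp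
  also have "\<dots> \<le> (\<Sum>j = 1..n. exp (k * L))"
  proof (intro sum_mono)
    fix j assume "j \<in> {1..n}"
    from step[OF this] have "(exp (y j) / exp (y (j + 1))) powr k = exp (k * a j)"
      by (simp add: powr_def exp_diff[symmetric])
    then show "(exp (y j) / exp (y (j + 1))) powr k \<le> exp (k * L)"
      using a_le[of j] \<open>k \<ge> 0\<close> by (simp add: mult_left_mono)
  qed
  also have "\<dots> = n * exp (k * L)" by simp
  finally have "exp ((d - k) * L) \<le> n"
    by (simp add: left_diff_distrib exp_diff divide_le_eq)
  moreover have "exp ((d - k) * L) = n + 1"
    using \<open>k < d\<close> by (simp add: L_def)
  ultimately show False by simp
qed

text \<open>At \<open>1 / x\<close> every ratio is inverted: on the left this flips the sign of
  \<open>k\<close>, on the right reindexing by \<open>\<sigma>\<close> produces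
  \<open>inv \<sigma>\<close>.\<close>

lemma cyclic_ineq_inv:
  assumes \<sigma>: "\<sigma> permutes {1..n}" and ineq: "cyclic_ineq n \<sigma> k"
  shows "cyclic_ineq n (inv \<sigma>) (- k)"
  unfolding cyclic_ineq_def
proof (intro allI impI)
  fix x :: "nat \<Rightarrow> real"
  assume pos: "\<forall>i\<in>{1..n}. x i > 0" and per: "x (n + 1) = x 1"
  have "(\<Sum>i = 1..n. x i / x (inv \<sigma> i)) = (\<Sum>i = 1..n. x (\<sigma> i) / x i)"
    using sum.permute[OF \<sigma>, of "\<lambda>i. x i / x (inv \<sigma> i)"]
    by (simp add: o_def permutes_inverses[OF \<sigma>])
  also have "\<dots> \<le> (\<Sum>i = 1..n. (x (i + 1) / x i) powr k)"
    using ineq[unfolded cyclic_ineq_def, rule_format, of "\<lambda>i. 1 / x i"] pos per by simp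
  also have "\<dots> = (\<Sum>i = 1..n. (x i / x (i + 1)) powr (- k))"
  proof (intro sum.cong refl)
    fix i assume "i \<in> {1..n}"
    then have "x i > 0" "x (i + 1) > 0"
      using pos per by (auto, cases "i = n") auto
    then show "(x (i + 1) / x i) powr k = (x i / x (i + 1)) powr (- k)"
      by (simp add: powr_def ln_div algebra_simps)
  qed
  finally show "(\<Sum>i = 1..n. x i / x (inv \<sigma> i)) \<le> (\<Sum>i = 1..n. (x i / x (i + 1)) powr (- k))" .
qed

lemma cyclic_ineq_nonneg_iff:
  assumes "\<sigma> permutes {1..n}" "n > 0" "k \<ge> 0"
  shows "cyclic_ineq n \<sigma> k \<longleftrightarrow> (\<forall>i\<in>{1..n}. real (card (arc n i (\<sigma> i))) \<le> k)"
  using cyclic_ineq_if_arcs_le card_arc_le_if_cyclic_ineq assms by blast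

lemma cyclic_ineq_nonpos_iff:
  assumes \<sigma>: "\<sigma> permutes {1..n}" and "n > 0" "k \<le> 0"
  shows "cyclic_ineq n \<sigma> k \<longleftrightarrow> (\<forall>i\<in>{1..n}. real (card (arc n (\<sigma> i) i)) \<le> - k)"
proof -
  \<comment> \<open>The exchange is an involution, so its one implication, used twice, gives an
    equivalence.\<close>
  have "cyclic_ineq n \<sigma> k \<longleftrightarrow> cyclic_ineq n (inv \<sigma>) (- k)"
    using cyclic_ineq_inv[OF \<sigma>] cyclic_ineq_inv[OF permutes_inv[OF \<sigma>], of "- k"]
    by (auto simp: permutes_inv_inv[OF \<sigma>])
  also have "\<dots> \<longleftrightarrow> (\<forall>i\<in>{1..n}. real (card (arc n i (inv \<sigma> i))) \<le> - k)"
    using assms by (intro cyclic_ineq_nonneg_iff permutes_inv) auto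
  also have "\<dots> \<longleftrightarrow> (\<forall>i\<in>\<sigma> ` {1..n}. real (card (arc n i (inv \<sigma> i))) \<le> - k)"
    by (simp only: permutes_image[OF \<sigma>])
  also have "\<dots> \<longleftrightarrow> (\<forall>i\<in>{1..n}. real (card (arc n (\<sigma> i) i)) \<le> - k)"
    by (simp add: permutes_inverses[OF \<sigma>])
  finally show ?thesis .
qed

theorem theorem2p2:
  fixes n :: nat and \<sigma> :: "nat \<Rightarrow> nat" and k :: real
  assumes "n > 1"
    and "\<sigma> permutes {1..n}"
  shows "(\<forall>x :: nat \<Rightarrow> real.
            (\<forall>i\<in>{1..n}. x i > 0) \<longrightarrow> x (n + 1) = x 1 \<longrightarrow>
            (\<Sum>i = 1..n. (x i / x (i + 1)) powr k) \<ge> (\<Sum>i = 1..n. x i / x (\<sigma> i)))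
     \<longleftrightarrow>
         (k \<ge> 0 \<and>
          (\<forall>i\<in>{1..n}. i \<le> \<sigma> i \<longrightarrow> k \<ge> real (\<sigma> i) - real i) \<and>
          (\<forall>i\<in>{1..n}. i > \<sigma> i \<longrightarrow> k \<ge> real n + real (\<sigma> i) - real i))
       \<or> (k \<le> 0 \<and>
          (\<forall>i\<in>{1..n}. i < \<sigma> i \<longrightarrow> - k \<ge> real n + real i - real (\<sigma> i)) \<and>
          (\<forall>i\<in>{1..n}. i \<ge> \<sigma> i \<longrightarrow> - k \<ge> real i - real (\<sigma> i)))"
proof -
  have \<sigma>_in: "\<sigma> i \<in> {1..n}" if "i \<in> {1..n}" for i
    using permutes_in_image[OF assms(2)] that by simp
  have up: "(\<forall>i\<in>{1..n}. real (card (arc n i (\<sigma> i))) \<le> k) \<longleftrightarrow>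
      (\<forall>i\<in>{1..n}. i \<le> \<sigma> i \<longrightarrow> k \<ge> real (\<sigma> i) - real i) \<and>
      (\<forall>i\<in>{1..n}. i > \<sigma> i \<longrightarrow> k \<ge> real n + real (\<sigma> i) - real i)"
    unfolding ball_conj_distrib[symmetric]
  proof (intro ball_cong refl)
    fix i assume i: "i \<in> {1..n}"
    show "(real (card (arc n i (\<sigma> i))) \<le> k) \<longleftrightarrow> (i \<le> \<sigma> i \<longrightarrow> k \<ge> real (\<sigma> i) - real i) \<and> (i > \<sigma> i \<longrightarrow> k \<ge> real n + real (\<sigma> i) - real i)"
      unfolding card_arc[OF i \<sigma>_in[OF i]] by auto
  qed
  \<comment> \<open>The arc now runs from \<open>\<sigma> i\<close> to \<open>i\<close> and wraps
    around exactly when \<open>i < \<sigma> i\<close>; fixed points therefore belong to the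
    non-strict case.\<close>
  have down: "(\<forall>i\<in>{1..n}. real (card (arc n (\<sigma> i) i)) \<le> - k) \<longleftrightarrow>
      (\<forall>i\<in>{1..n}. i < \<sigma> i \<longrightarrow> - k \<ge> real n + real i - real (\<sigma> i)) \<and>
      (\<forall>i\<in>{1..n}. i \<ge> \<sigma> i \<longrightarrow> - k \<ge> real i - real (\<sigma> i))"
    unfolding ball_conj_distrib[symmetric]
  proof (intro ball_cong refl)
    fix i assume i: "i \<in> {1..n}"
    show "(real (card (arc n (\<sigma> i) i)) \<le> - k) \<longleftrightarrow> (i < \<sigma> i \<longrightarrow> - k \<ge> real n + real i - real (\<sigma> i)) \<and> (i \<ge> \<sigma> i \<longrightarrow> - k \<ge> real i - real (\<sigma> i))"
      unfolding card_arc[OF \<sigma>_in[OF i] i] by auto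
  qed
  \<comment> \<open>At \<open>k = 0\<close> both criteria apply and each is equivalent to the
    inequality, so the disjunction is still correct there.\<close>
  have "cyclic_ineq n \<sigma> k \<longleftrightarrow>
      k \<ge> 0 \<and> (\<forall>i\<in>{1..n}. real (card (arc n i (\<sigma> i))) \<le> k) \<or>
      k \<le> 0 \<and> (\<forall>i\<in>{1..n}. real (card (arc n (\<sigma> i) i)) \<le> - k)"
    using cyclic_ineq_nonneg_iff[OF assms(2), of k] cyclic_ineq_nonpos_iff[OF assms(2), of k] assms(1)
    by (cases "k \<ge> 0"; cases "k \<le> 0") auto
  then show ?thesis
    unfolding up down cyclic_ineq_def .
qed

end
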